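(* Let $\mathbb{F}$ be an algebraically closed field of characteristic zero and let $A$ be a non-Lie nilpotent Leibniz algebra over $\mathbb{F}$ with $\dim(A)=3$. Then $A$ is isomorphic to a Leibniz algebra spanned by $\{x,y,z\}$ with the nonzero products (all products of basis elements not listed being zero) given by one of the following: (1) $[x,x]=y,\ [x,y]=z$; (2) $[x,x]=z$; (3) $[x,y]=z,\ [y,x]=z$; (4) $[x,y]=z,\ [y,x]=-z,\ [y,y]=z$; (5) $[x,y]=z,\ [y,x]=\alpha z$ for some $\alpha\in\mathbb{F}\setminus\{1,-1\}$.
   Context: A (left) Leibniz algebra over $\mathbb{F}$ is an $\mathbb{F}$-vector space $A$ with a bilinear map $[\,,\,]:A\times A\to A$ satisfying $[a,[b,c]]=[[a,b],c]+[b,[a,c]]$ for all $a,b,c\in A$. It is a Lie algebra if and only if $[a,a]=0$ for all $a\in A$; otherwise it is called non-Lie. $A$ is nilpotent if for some $c$ every product of $c+1$ elements of $A$ (with any bracketing) is $0$. *)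

theory Defs
  imports "HOL-Analysis.Analysis"
begin

locale leibniz_algebra = vector_space scale
  for scale :: "'f::field \<Rightarrow> 'a::ab_group_add \<Rightarrow> 'a" +
  fixes br :: "'a \<Rightarrow> 'a \<Rightarrow> 'a"
  assumes linear_right: "Vector_Spaces.linear scale scale (\<lambda>b. br a b)"
    and linear_left: "Vector_Spaces.linear scale scale (\<lambda>a. br a b)"
    and leibniz: "br a (br b c) = br (br a b) c + br b (br a c)"

definition is_lie :: "('a::ab_group_add \<Rightarrow> 'a \<Rightarrow> 'a) \<Rightarrow> bool" where
  "is_lie br \<longleftrightarrow> (\<forall>a. br a a = 0)"

text \<open>\<^term>\<open>bracketed_product br n p\<close>: the element \<open>p\<close> is a product of \<open>n\<close> elements
  of the algebra, with some bracketing.\<close>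

inductive bracketed_product :: "('a \<Rightarrow> 'a \<Rightarrow> 'a) \<Rightarrow> nat \<Rightarrow> 'a \<Rightarrow> bool"
  for br where
  single: "bracketed_product br 1 a"
| bracket: "bracketed_product br m p \<Longrightarrow> bracketed_product br n q
            \<Longrightarrow> bracketed_product br (m + n) (br p q)"

definition nilpotent_algebra :: "('a::ab_group_add \<Rightarrow> 'a \<Rightarrow> 'a) \<Rightarrow> bool" where
  "nilpotent_algebra br \<longleftrightarrow> (\<exists>c. \<forall>p. bracketed_product br (c + 1) p \<longrightarrow> p = 0)"

definition leibniz_isomorphic ::
  "('f::field \<Rightarrow> 'a::ab_group_add \<Rightarrow> 'a) \<Rightarrow> ('a \<Rightarrow> 'a \<Rightarrow> 'a) \<Rightarrow>
   ('f \<Rightarrow> 'b::ab_group_add \<Rightarrow> 'b) \<Rightarrow> ('b \<Rightarrow> 'b \<Rightarrow> 'b) \<Rightarrow> bool" where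
  "leibniz_isomorphic s1 br1 s2 br2 \<longleftrightarrow>
     leibniz_algebra s1 br1 \<and> leibniz_algebra s2 br2 \<and>
     (\<exists>\<phi>. Vector_Spaces.linear s1 s2 \<phi> \<and> bij \<phi> \<and> (\<forall>a b. \<phi> (br1 a b) = br2 (\<phi> a) (\<phi> b)))"

text \<open>The bracket on \<open>F\<^sup>3\<close> given by a list of products of standard basis vectors: an entry
  \<open>((i, j), v)\<close> says that the product of the \<open>i\<close>-th and the \<open>j\<close>-th basis vector is \<open>v\<close>.
  Products not listed are zero, and the bracket is extended bilinearly. In the index type
  \<open>3\<close> the numeral \<open>3\<close> equals \<open>0\<close>; the indices \<open>1, 2, 3\<close> are pairwise distinct and
  exhaust the type.\<close>

definition basis_product :: "((3 \<times> 3) \<times> ('f^3)) list \<Rightarrow> 3 \<Rightarrow> 3 \<Rightarrow> ('f::field)^3" where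
  "basis_product ps i j = (case map_of ps (i, j) of None \<Rightarrow> 0 | Some v \<Rightarrow> v)"

definition table_bracket :: "((3 \<times> 3) \<times> ('f^3)) list \<Rightarrow> 'f^3 \<Rightarrow> 'f^3 \<Rightarrow> ('f::field)^3" where
  "table_bracket ps u v = (\<Sum>i\<in>UNIV. \<Sum>j\<in>UNIV. (u $ i * v $ j) *s basis_product ps i j)"

text \<open>In the classification, \<open>x, y, z\<close> are the standard basis vectors with indices \<open>1, 2, 3\<close>.\<close>

abbreviation basis_y :: "('f::field)^3" where "basis_y \<equiv> axis 2 1"
abbreviation basis_z :: "('f::field)^3" where "basis_z \<equiv> axis 3 1"

end

theory Submission
  imports Defs
begin

text \<open>Every square \<open>[a, a]\<close> annihilates the algebra from the left, and every left multiplication is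
  nilpotent. If \<open>[x, [x, x]] \<noteq> 0\<close> for some \<open>x\<close>, then \<open>x, [x, x], [x, [x, x]]\<close> is a basis of type (1).
  Otherwise take \<open>x\<close> with \<open>w = [x, x] \<noteq> 0\<close>; nilpotency forces \<open>w\<close> to be central and all
  products to be multiples of \<open>w\<close>, so that the bracket is a bilinear form on a plane, with matrix
  \<open>(1, 0; r, c)\<close> in a suitable basis \<open>x, t\<close>. Its isotropic vectors are \<open>t + m x\<close> for the roots \<open>m\<close>
  of \<open>X\<^sup>2 + r X + c\<close>. Two distinct roots give an isotropic basis and types (3) and (5); a
  double root gives types (2) and (4).\<close>

section \<open>Bases of a three-dimensional vector space\<close>

text \<open>Independence of an ordered triple rather than of a set, so that coinciding vectors are
  excluded.\<close>

definition (in vector_space) indep3 :: "'b \<Rightarrow> 'b \<Rightarrow> 'b \<Rightarrow> bool" where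
  "indep3 X Y Z \<longleftrightarrow> (\<forall>a b c. scale a X + scale b Y + scale c Z = 0 \<longrightarrow> a = 0 \<and> b = 0 \<and> c = 0)"

lemma (in vector_space) indep3D:
  assumes "indep3 X Y Z" "scale a X + scale b Y + scale c Z = 0"
  shows "a = 0" "b = 0" "c = 0"
  using assms unfolding indep3_def by blast+

lemma (in vector_space) indep3_imp_independent:
  assumes "indep3 X Y Z"
  shows "independent {X, Y, Z}" "card {X, Y, Z} = 3"
proof -
  have ne: "X \<noteq> Y" "X \<noteq> Z" "Y \<noteq> Z"
    using indep3D[OF assms, of 1 "-1" 0] indep3D[OF assms, of 1 0 "-1"]
      indep3D[OF assms, of 0 1 "-1"] by auto
  then show "card {X, Y, Z} = 3" by simp
  show "independent {X, Y, Z}"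
  proof (rule independent_if_scalars_zero)
    fix f x
    assume "(\<Sum>x\<in>{X, Y, Z}. scale (f x) x) = 0" and "x \<in> {X, Y, Z}"
    then show "f x = 0"
      using ne indep3D[OF assms, of "f X" "f Y" "f Z"] by (auto simp: add.assoc)
  qed simp
qed

lemma (in vector_space) dim3_basis:
  assumes "dim UNIV = 3"
  obtains B where "finite B" "card B = 3" "independent B" "span B = UNIV"
proof -
  obtain B where B: "independent B" "UNIV \<subseteq> span B" "card B = dim UNIV"
    using basis_exists[of UNIV] by metis
  with assms have "card B = 3" by simp
  with B that[of B] show thesis
    by (metis card.infinite top.extremum_uniqueI zero_neq_numeral)
qed

text \<open>A vector outside the span would extend the triple to four independent vectors in a space
  spanned by three.\<close>

lemma (in vector_space) dim3_spanE:
  assumes "dim UNIV = 3" "indep3 X Y Z"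
  obtains a b c where "v = scale a X + scale b Y + scale c Z"
proof -
  obtain B where B: "finite B" "card B = 3" "span B = UNIV"
    using dim3_basis[OF assms(1)] by metis
  note ind = indep3_imp_independent[OF assms(2)]
  have "v \<in> span {X, Y, Z}"
  proof (rule ccontr)
    assume v: "v \<notin> span {X, Y, Z}"
    then have "independent (insert v {X, Y, Z})"
      using ind(1) independent_insertI by blast
    then have "card (insert v {X, Y, Z}) \<le> 3"
      using independent_span_bound[OF B(1)] B by auto
    moreover have "v \<notin> {X, Y, Z}" using v by (meson span_base)
    ultimately show False using ind(2) by simp
  qed
  then obtain a b c where "v - scale a X - scale b Y - scale c Z = 0"
    by (auto simp: span_breakdown_eq)
  then have "v = scale a X + scale b Y + scale c Z" by (simp add: algebra_simps)
  then show thesis by (rule that)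
qed

lemma (in vector_space) dim3_extend:
  assumes "dim UNIV = 3" and xw: "\<And>a b. scale a x + scale b w = 0 \<Longrightarrow> a = 0 \<and> b = 0"
  obtains t where "indep3 x t w"
proof -
  obtain B where B: "card B = 3" "independent B" "span B = UNIV"
    using dim3_basis[OF assms(1)] by metis
  have "\<not> card B \<le> card {x, w}" using B(1) by (auto simp: card_insert_if)
  then have "\<not> B \<subseteq> span {x, w}" using independent_span_bound[of "{x, w}" B] B(2) by auto
  then obtain t where t: "t \<notin> span {x, w}" by blast
  have "a = 0 \<and> b = 0 \<and> c = 0" if eq: "scale a x + scale b t + scale c w = 0" for a b c
  proof -
    have "b = 0"
    proof (rule ccontr)
      assume "b \<noteq> 0"
      have "scale b t = - scale a x - scale c w"
        using arg_cong[OF eq, of "\<lambda>v. v - scale a x - scale c w"] by simp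
      then have "scale (inverse b) (scale b t) \<in> span {x, w}"
        by (auto intro!: span_scale span_diff span_neg intro: span_base)
      with \<open>b \<noteq> 0\<close> t show False by simp
    qed
    then show ?thesis using eq xw by simp
  qed
  then show thesis using that unfolding indep3_def by blast
qed

section \<open>Consequences of the Leibniz identity and of nilpotency\<close>

context leibniz_algebra
begin

lemma br_add_right: "br a (b + c) = br a b + br a c"
  and br_scale_right: "br a (scale k b) = scale k (br a b)"
  using linear_right by (simp_all add: Vector_Spaces.linear_iff)

lemma br_add_left: "br (a + b) c = br a c + br b c"
  and br_scale_left: "br (scale k a) b = scale k (br a b)"
  using linear_left[of c] linear_left[of b] by (simp_all add: Vector_Spaces.linear_iff)

lemma br_zero_right [simp]: "br a 0 = 0"
  and br_zero_left [simp]: "br 0 a = 0"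
  using br_scale_right[of a 0 0] br_scale_left[of 0 0 a] by simp_all

lemma br_minus_right: "br a (- b) = - br a b"
  and br_minus_left: "br (- a) b = - br a b"
  using br_scale_right[of a "-1" b] br_scale_left[of "-1" a b] by simp_all

lemma br_diff_right: "br a (b - c) = br a b - br a c"
  and br_diff_left: "br (a - b) c = br a c - br b c"
  using br_add_right[of a b "- c"] br_add_left[of a "- b" c]
  by (simp_all add: br_minus_right br_minus_left)

lemmas br_linear = br_add_right br_scale_right br_minus_right br_diff_right
  br_add_left br_scale_left br_minus_left br_diff_left

lemma br_square_left [simp]: "br (br a a) b = 0"
  using leibniz[of a a b] by simp

text \<open>Polarization: the symmetrized product is
  \<open>[a + b, a + b] - [a, a] - [b, b]\<close>, a combination of squares.\<close>

lemma br_symmetrized_left: "br (br a b + br b a) c = 0"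
proof -
  have "br (br (a + b) (a + b)) c = 0" by (rule br_square_left)
  then show ?thesis by (simp add: br_add_left br_add_right add.commute)
qed

lemma bracketed_product_funpow: "bracketed_product br (n + 1) ((br a ^^ n) v)"
proof (induction n)
  case 0
  then show ?case using bracketed_product.single by auto
next
  case (Suc n)
  show ?case
    using bracketed_product.bracket[OF bracketed_product.single[of br a] Suc] by simp
qed

lemma nilpotent_funpow:
  assumes "nilpotent_algebra br"
  obtains n where "\<And>a v. (br a ^^ n) v = 0"
  using assms bracketed_product_funpow unfolding nilpotent_algebra_def by blast

text \<open>Some power of left multiplication by \<open>a\<close> vanishes, while its
  \<open>n\<close>-th power maps \<open>v\<close> to \<open>k ^ n\<close> times
  \<open>v\<close>.\<close>

lemma nilpotent_eigenvalue:
  assumes "nilpotent_algebra br" "br a v = scale k v" "v \<noteq> 0"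
  shows "k = 0"
proof -
  obtain n where n: "(br a ^^ n) v = 0" using nilpotent_funpow[OF assms(1)] by metis
  have "(br a ^^ n) v = scale (k ^ n) v"
    by (induction n) (simp_all add: br_scale_right assms(2) mult.commute)
  with n assms(3) show ?thesis by simp
qed

section \<open>Transfer of multiplication tables\<close>

definition comb3 :: "'a \<Rightarrow> 'a \<Rightarrow> 'a \<Rightarrow> 'f^3 \<Rightarrow> 'a" where
  "comb3 X Y Z v = scale (v $ 1) X + scale (v $ 2) Y + scale (v $ 3) Z"

lemma comb3_table_bracket:
  assumes "br X X = comb3 X Y Z (basis_product ps 1 1)"
    and "br X Y = comb3 X Y Z (basis_product ps 1 2)"
    and "br X Z = comb3 X Y Z (basis_product ps 1 3)"
    and "br Y X = comb3 X Y Z (basis_product ps 2 1)"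
    and "br Y Y = comb3 X Y Z (basis_product ps 2 2)"
    and "br Y Z = comb3 X Y Z (basis_product ps 2 3)"
    and "br Z X = comb3 X Y Z (basis_product ps 3 1)"
    and "br Z Y = comb3 X Y Z (basis_product ps 3 2)"
    and "br Z Z = comb3 X Y Z (basis_product ps 3 3)"
  shows "comb3 X Y Z (table_bracket ps u v) = br (comb3 X Y Z u) (comb3 X Y Z v)"
proof -
  have add: "comb3 X Y Z (p + q) = comb3 X Y Z p + comb3 X Y Z q" for p q
    by (simp add: comb3_def scale_left_distrib algebra_simps)
  have scl: "comb3 X Y Z (k *s p) = scale k (comb3 X Y Z p)" for k p
    by (simp add: comb3_def scale_right_distrib)
  have "br (comb3 X Y Z u) (comb3 X Y Z v) =
      scale (u$1 * v$1) (br X X) + scale (u$1 * v$2) (br X Y) + scale (u$1 * v$3) (br X Z) +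
      (scale (u$2 * v$1) (br Y X) + scale (u$2 * v$2) (br Y Y) + scale (u$2 * v$3) (br Y Z)) +
      (scale (u$3 * v$1) (br Z X) + scale (u$3 * v$2) (br Z Y) + scale (u$3 * v$3) (br Z Z))"
    unfolding comb3_def[of X Y Z u] comb3_def[of X Y Z v]
    by (simp add: br_linear scale_right_distrib mult.commute ac_simps)
  also have "\<dots> = comb3 X Y Z (table_bracket ps u v)"
    unfolding table_bracket_def sum_3 add scl assms ..
  finally show ?thesis ..
qed

text \<open>The map \<open>comb3 X Y Z\<close> is a bijection compatible with the brackets, and the
  isomorphism is its inverse. The Leibniz axioms for the table are pulled back along it, so no table
  has to be checked by hand.\<close>

lemma leibniz_isomorphic_tableI:
  assumes dim: "dim UNIV = 3" and ind: "indep3 X Y Z"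
    and hom: "\<And>u v. comb3 X Y Z (table_bracket ps u v) = br (comb3 X Y Z u) (comb3 X Y Z v)"
  shows "leibniz_isomorphic scale br (*s) (table_bracket ps)"
proof -
  define \<psi> where "\<psi> = comb3 X Y Z"
  note hom = hom[folded \<psi>_def]
  have add: "\<psi> (u + v) = \<psi> u + \<psi> v" for u v
    by (simp add: \<psi>_def comb3_def scale_left_distrib algebra_simps)
  have scl: "\<psi> (k *s u) = scale k (\<psi> u)" for k u
    by (simp add: \<psi>_def comb3_def scale_right_distrib)
  have inj: "\<psi> u = \<psi> v \<Longrightarrow> u = v" for u v
  proof -
    assume "\<psi> u = \<psi> v"
    then have "scale (u$1 - v$1) X + scale (u$2 - v$2) Y + scale (u$3 - v$3) Z = 0"
      by (simp add: \<psi>_def comb3_def scale_left_diff_distrib algebra_simps)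
    from indep3D[OF ind this] show "u = v" by (simp add: vec_eq_iff forall_3)
  qed
  have "\<exists>u. v = \<psi> u" for v
  proof -
    obtain a b c where "v = scale a X + scale b Y + scale c Z"
      using dim3_spanE[OF dim ind] by metis
    then have "v = \<psi> (vector [a, b, c])" by (simp add: \<psi>_def comb3_def)
    then show ?thesis ..
  qed
  then have bij: "bij \<psi>" by (auto simp: bij_def inj_def surj_def dest: inj)
  have alg: "leibniz_algebra (*s) (table_bracket ps)"
  proof (intro leibniz_algebra.intro leibniz_algebra_axioms.intro vec.vector_space_axioms)
    show "Vector_Spaces.linear (*s) (*s) (\<lambda>b. table_bracket ps a b)" for a
      unfolding Vector_Spaces.linear_iff
      by (intro conjI vec.vector_space_axioms allI inj) (simp_all add: hom add scl br_linear)
    show "Vector_Spaces.linear (*s) (*s) (\<lambda>a. table_bracket ps a b)" for b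
      unfolding Vector_Spaces.linear_iff
      by (intro conjI vec.vector_space_axioms allI inj) (simp_all add: hom add scl br_linear)
    show "table_bracket ps a (table_bracket ps b c) =
        table_bracket ps (table_bracket ps a b) c + table_bracket ps b (table_bracket ps a c)"
      for a b c
      by (rule inj) (simp only: hom add leibniz[symmetric])
  qed
  define \<phi> where "\<phi> = inv \<psi>"
  have \<psi>\<phi>: "\<psi> (\<phi> a) = a" for a
    unfolding \<phi>_def using bij by (simp add: bij_is_surj surj_f_inv_f)
  have "Vector_Spaces.linear scale (*s) \<phi>"
    unfolding Vector_Spaces.linear_iff
    by (intro conjI vec.vector_space_axioms vector_space_axioms allI inj) (simp_all add: add scl \<psi>\<phi>)
  moreover have "bij \<phi>" unfolding \<phi>_def using bij by (rule bij_imp_bij_inv)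
  moreover have "\<phi> (br a b) = table_bracket ps (\<phi> a) (\<phi> b)" for a b
    by (rule inj) (simp add: hom \<psi>\<phi>)
  ultimately show ?thesis
    using alg leibniz_algebra_axioms unfolding leibniz_isomorphic_def by blast
qed

section \<open>The case of a nonzero cube\<close>

text \<open>Left multiplication by \<open>x\<close> shifts the chain; applying it twice to a
  relation isolates \<open>a\<close>, applying it once then isolates \<open>b\<close>.\<close>

lemma chain_indep3:
  assumes "br x e2 = 0" "e2 = br x e1" "e1 = br x e0" "e2 \<noteq> 0"
  shows "indep3 e0 e1 e2"
  unfolding indep3_def
proof (intro allI impI)
  fix a b c
  assume eq: "scale a e0 + scale b e1 + scale c e2 = 0"
  have eq1: "scale a e1 + scale b e2 = 0"
    using arg_cong[OF eq, of "br x"] assms(1) by (simp add: br_linear flip: assms(2,3))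
  have "scale a e2 = 0"
    using arg_cong[OF eq1, of "br x"] assms(1) by (simp add: br_linear flip: assms(2))
  with assms(4) eq eq1 show "a = 0 \<and> b = 0 \<and> c = 0" by simp
qed

lemma isomorphic_one_generator:
  assumes dim: "dim UNIV = 3" and nil: "nilpotent_algebra br" and ne: "br x (br x x) \<noteq> 0"
  shows "leibniz_isomorphic scale br (*s) (table_bracket [((1, 1), basis_y), ((1, 2), basis_z)])"
proof -
  define e where "e k = (br x ^^ k) x" for k
  have eS: "e (Suc k) = br x (e k)" for k by (simp add: e_def)
  obtain n where n: "e n = 0" using nilpotent_funpow[OF nil] unfolding e_def by metis
  have low: "e 0 = x" "e (Suc 0) = br x x" "e (Suc (Suc 0)) = br x (br x x)"
    by (simp_all add: e_def)
  define k where "k = (LEAST k. e k = 0)"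
  have k0: "e k = 0" and kmin: "\<And>j. j < k \<Longrightarrow> e j \<noteq> 0"
    using LeastI[of "\<lambda>k. e k = 0", OF n] not_less_Least unfolding k_def by auto
  have "e 0 \<noteq> 0" "e (Suc 0) \<noteq> 0" "e (Suc (Suc 0)) \<noteq> 0" unfolding low using ne by auto
  then have "k \<noteq> 0" "k \<noteq> 1" "k \<noteq> 2" using k0 by (metis One_nat_def numeral_2_eq_2)+
  \<comment> \<open>The vectors \<open>e j\<close>, \<open>e (j + 1)\<close>,
    \<open>e (j + 2)\<close> are the last three nonzero iterates, hence a basis.\<close>
  then obtain j where j: "k = Suc (Suc (Suc j))"
    by (metis One_nat_def numeral_2_eq_2 old.nat.exhaust)
  have last: "br x (e (Suc (Suc j))) = 0" "e (Suc (Suc j)) \<noteq> 0"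
    using k0 kmin[of "Suc (Suc j)"] unfolding j eS by auto
  have ind: "indep3 (e j) (e (Suc j)) (e (Suc (Suc j)))"
    by (rule chain_indep3[OF last(1) eS eS last(2)])
  \<comment> \<open>Otherwise \<open>e (j - 1)\<close> is a combination of this basis, and
    multiplying by \<open>x\<close> expresses \<open>e j\<close> through \<open>e (j + 1)\<close>
    and \<open>e (j + 2)\<close>.\<close>
  have "j = 0"
  proof (rule ccontr)
    assume "j \<noteq> 0"
    then obtain i where i: "j = Suc i" using not0_implies_Suc by blast
    obtain a b c where "e i = scale a (e j) + scale b (e (Suc j)) + scale c (e (Suc (Suc j)))"
      using dim3_spanE[OF dim ind] by metis
    then have "br x (e i) = scale a (br x (e j)) + scale b (br x (e (Suc j)))"
      using last(1) by (simp add: br_linear)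
    then have "scale 1 (e j) + scale (- a) (e (Suc j)) + scale (- b) (e (Suc (Suc j))) = 0"
      unfolding eS[symmetric] i[symmetric] by simp
    from indep3D(1)[OF ind this] show False by simp
  qed
  with ind last(1) have ind: "indep3 x (br x x) (br x (br x x))" and xz: "br x (br x (br x x)) = 0"
    using low by auto
  \<comment> \<open>In this instance of the Leibniz identity the other two terms have
    \<open>[x, x]\<close> acting from the left, so they vanish.\<close>
  have z: "br (br x (br x x)) c = 0" for c
    using leibniz[of x "br x x" c] by simp
  show ?thesis
    by (rule leibniz_isomorphic_tableI[OF dim ind], rule comb3_table_bracket)
      (simp_all add: basis_product_def comb3_def axis_def xz z)
qed

section \<open>Normal form when all cubes vanish\<close>

text \<open>On a basis \<open>w, x, t\<close> left multiplication by \<open>a\<close> is triangular with diagonal \<open>0, 0, q\<close>. The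
  vector \<open>v = [a, [a, t]]\<close> satisfies \<open>[a, v] = q v\<close> and has \<open>t\<close>-coordinate \<open>q\<^sup>2\<close>.\<close>

lemma nilpotent_diagonal_coefficient:
  assumes nil: "nilpotent_algebra br" and ind: "indep3 x t w"
    and at: "br a t = scale p x + scale q t + scale r w"
    and ax: "br a x = scale d w" and aw: "br a w = 0"
  shows "q = 0"
proof -
  define v where "v = br a (br a t)"
  have v: "v = scale (p * d) w + scale q (br a t)"
    by (subst at) (simp add: v_def at br_linear ax aw)
  have av: "br a v = scale q v"
    by (subst v) (simp add: br_linear aw flip: v_def)
  have "scale (q * p) x + scale (q * q) t + scale (p * d + q * r) w = v"
    unfolding v at by (simp add: algebra_simps)
  moreover have "q = 0 \<or> v = 0" using nilpotent_eigenvalue[OF nil av] by blast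
  ultimately show ?thesis using indep3D(2)[OF ind] by force
qed

text \<open>Extend \<open>x, w\<close> to a basis and remove the unwanted coordinates of the
  products one by one: diagonal ones by nilpotency, others because squares annihilate from the
  left.\<close>

lemma form_normal_form:
  assumes two: "(2::'f) \<noteq> 0" and dim: "dim UNIV = 3" and nil: "nilpotent_algebra br"
    and cube: "\<And>x. br x (br x x) = 0" and ne: "br x x \<noteq> 0"
  obtains t r c where "indep3 x t (br x x)" "br x t = 0" "br t x = scale r (br x x)"
    "br t t = scale c (br x x)" "br t (br x x) = 0"
proof -
  define w where "w = br x x"
  have xw: "br x w = 0" and w: "br w b = 0" for b
    by (simp_all add: w_def cube)
  have xwind: "a = 0 \<and> b = 0" if eq: "scale a x + scale b w = 0" for a b
  proof -
    have "scale a w = 0"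
      using arg_cong[OF eq, of "br x"] by (simp add: br_linear xw flip: w_def)
    with eq ne show ?thesis by (simp add: w_def)
  qed
  obtain s where sind: "indep3 x s w" using dim3_extend[OF dim xwind] by metis
  obtain p q e where xs: "br x s = scale p x + scale q s + scale e w"
    using dim3_spanE[OF dim sind] by metis
  have "q = 0"
    by (rule nilpotent_diagonal_coefficient[OF nil sind xs, of 1]) (simp_all add: w_def cube)
  \<comment> \<open>Since \<open>[x, x] = w\<close>, this shift cancels the
    \<open>w\<close>-coordinate of \<open>[x, s]\<close>.\<close>
  define t where "t = s + scale (- e) x"
  have xt: "br x t = scale p x"
    by (simp add: t_def br_linear xs \<open>q = 0\<close> flip: w_def)
  have tind: "indep3 x t w"
    unfolding indep3_def
  proof (intro allI impI)
    fix a b c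
    assume "scale a x + scale b t + scale c w = 0"
    then have "scale (a - b * e) x + scale b s + scale c w = 0"
      by (simp add: t_def algebra_simps)
    from indep3D[OF sind this] show "a = 0 \<and> b = 0 \<and> c = 0" by simp
  qed
  obtain p' q' r where tx: "br t x = scale p' x + scale q' t + scale r w"
    using dim3_spanE[OF dim tind] by metis
  \<comment> \<open>Expanded in the basis \<open>x, t, w\<close>, this gives
    \<open>q' * q' = 0\<close> and then \<open>p + p' = 0\<close>.\<close>
  have "br (br x t + br t x) x = 0" by (rule br_symmetrized_left)
  then have "scale (q' * p') x + scale (q' * q') t + scale (p + p' + q' * r) w = 0"
    by (simp add: xt tx br_linear w algebra_simps flip: w_def)
  from indep3D[OF tind this] have q': "q' = 0" and p': "p' = - p"
    by (auto simp: add_eq_0_iff)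
  \<comment> \<open>The vector \<open>w\<close> is an eigenvector of left multiplication by
    \<open>t\<close> with eigenvalue \<open>-2p\<close>; nilpotency makes it zero, and
    \<open>p = 0\<close> as 2 is invertible.\<close>
  have "br t w = br (br t x) x + br x (br t x)" unfolding w_def by (rule leibniz)
  also have "\<dots> = scale (- p + - p) w"
    unfolding tx q' p' scale_left_distrib br_linear w xw w_def[symmetric] by simp
  finally have tw: "br t w = scale (- p + - p) w" .
  then have "- p + - p = 0" using nilpotent_eigenvalue[OF nil] ne unfolding w_def by blast
  then have "2 * p = 0" by (simp only: mult_2 neg_equal_0_iff_equal flip: minus_add_distrib)
  then have p: "p = 0" using two by simp
  have tx: "br t x = scale r w" and tw: "br t w = 0" and xt: "br x t = 0"
    using tx tw xt q' p' p by simp_all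
  obtain a b c where tt: "br t t = scale a x + scale b t + scale c w"
    using dim3_spanE[OF dim tind] by metis
  have b: "b = 0" by (rule nilpotent_diagonal_coefficient[OF nil tind tt tx tw])
  have "br (br t t) x = 0" by (rule br_square_left)
  then have "scale a w = 0" unfolding tt by (simp add: br_linear b w flip: w_def)
  then have a: "a = 0" using ne unfolding w_def by simp
  show thesis
    using that[of t r c] tind xt tx tw tt a b unfolding w_def by simp
qed

section \<open>Tables obtained from the roots\<close>

text \<open>Writing \<open>r = - m\<^sub>1 - m\<^sub>2\<close> and \<open>c = m\<^sub>1 m\<^sub>2\<close>, one finds \<open>[t + a x, t + b x] = (m\<^sub>1 m\<^sub>2 - (m\<^sub>1 + m\<^sub>2) b + a b) w\<close>,
  which vanishes for \<open>a = b = m\<^sub>i\<close>.\<close>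

context
  fixes x t w :: 'a and m1 m2 :: 'f
  assumes dim: "dim UNIV = 3" and ind: "indep3 x t w"
    and xx: "br x x = w" and xt: "br x t = 0" and tx: "br t x = scale (- m1 - m2) w"
    and tt: "br t t = scale (m1 * m2) w"
    and central: "\<And>b. br w b = 0" "br x w = 0" "br t w = 0"
begin

lemma isomorphic_distinct_roots:
  assumes ne: "m1 \<noteq> m2" and m2: "m2 \<noteq> 0"
  shows "leibniz_isomorphic scale br (*s)
    (table_bracket [((1, 2), basis_z), ((2, 1), (- m1 / m2) *s basis_z)])"
proof -
  \<comment> \<open>This is the coefficient of \<open>w\<close> in \<open>[X, Y]\<close>, nonzero by
    the assumptions on the roots.\<close>
  define k where "k = m2 * (m1 - m2)"
  define X Y Z where "X = t + scale m1 x" and "Y = t + scale m2 x" and "Z = scale k w"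
  have k: "k \<noteq> 0" using assms by (simp add: k_def)
  have ind': "indep3 X Y Z"
    unfolding indep3_def
  proof (intro allI impI)
    fix a b c
    assume "scale a X + scale b Y + scale c Z = 0"
    then have "scale (a * m1 + b * m2) x + scale (a + b) t + scale (c * k) w = 0"
      by (simp add: X_def Y_def Z_def algebra_simps)
    note z = indep3D[OF ind this]
    then have b: "b = - a" and c: "c = 0" using k by (simp_all add: add_eq_0_iff)
    with z(1) have "a * (m1 - m2) = 0" by (simp add: algebra_simps)
    with ne b c show "a = 0 \<and> b = 0 \<and> c = 0" by simp
  qed
  have B: "br (t + scale a x) (t + scale b x) = scale (m1 * m2 + (- m1 - m2) * b + a * b) w" for a b
    unfolding br_linear xx xt tx tt by (simp add: algebra_simps)
  have XX: "br X X = 0" and YY: "br Y Y = 0"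
    unfolding X_def Y_def B by (simp_all add: algebra_simps)
  have XY: "br X Y = Z"
    unfolding X_def Y_def Z_def B k_def by (simp add: algebra_simps)
  have "m1 * m2 + (- m1 - m2) * m1 + m2 * m1 = (- m1 / m2) * k"
    using m2 by (simp add: k_def field_simps)
  then have YX: "br Y X = scale (- m1 / m2) Z"
    unfolding X_def Y_def Z_def B scale_scale by simp
  have Z: "br Z b = 0" "br X Z = 0" "br Y Z = 0" for b
    by (simp_all add: X_def Y_def Z_def br_linear central)
  show ?thesis
    by (rule leibniz_isomorphic_tableI[OF dim ind'], rule comb3_table_bracket)
      (simp_all add: basis_product_def comb3_def axis_def XX YY XY YX Z)
qed

lemma isomorphic_zero_root:
  assumes "m1 = 0" "m2 = 0"
  shows "leibniz_isomorphic scale br (*s) (table_bracket [((1, 1), basis_z)])"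
  by (rule leibniz_isomorphic_tableI[OF dim ind], rule comb3_table_bracket)
    (simp_all add: basis_product_def comb3_def axis_def xx xt tx tt central assms)

lemma isomorphic_double_root:
  assumes "m1 = m2" "m2 \<noteq> 0"
  shows "leibniz_isomorphic scale br (*s)
    (table_bracket [((1, 2), basis_z), ((2, 1), - basis_z), ((2, 2), basis_z)])"
proof -
  \<comment> \<open>The isotropic vector \<open>t + m2 x\<close> scaled by \<open>- 1 / m2\<close>,
    which makes \<open>[X, x] = w\<close>. The vector \<open>x\<close> itself plays the role of the
    table's \<open>y\<close>.\<close>
  define X where "X = scale (- 1 / m2) t + scale (- 1) x"
  have ind': "indep3 X x w"
    unfolding indep3_def
  proof (intro allI impI)
    fix a b c
    assume "scale a X + scale b x + scale c w = 0"
    then have "scale (b - a) x + scale (a * (- 1 / m2)) t + scale c w = 0"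
      by (simp add: X_def algebra_simps)
    from indep3D[OF ind this] assms(2) show "a = 0 \<and> b = 0 \<and> c = 0" by simp
  qed
  have "br X x = scale ((- 1 / m2) * (- m1 - m2) - 1) w"
    unfolding X_def br_linear xx tx by (simp add: algebra_simps)
  also have "(- 1 / m2) * (- m1 - m2) - 1 = 1" using assms by (simp add: field_simps)
  finally have Xx: "br X x = w" by simp
  have xX: "br x X = - w" unfolding X_def br_linear xx xt by simp
  have "br X X = scale (- 1 / m2) (br X t) + scale (- 1) (br X x)"
    by (subst (2) X_def) (simp only: br_linear)
  also have "br X t = scale (- 1 / m2 * (m1 * m2)) w"
    unfolding X_def br_linear xt tt by simp
  also have "- 1 / m2 * (m1 * m2) = - m1" using assms(2) by simp
  finally have XX: "br X X = 0" using assms by (simp add: Xx)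
  have Xw: "br X w = 0" by (simp add: X_def br_linear central)
  show ?thesis
    by (rule leibniz_isomorphic_tableI[OF dim ind'], rule comb3_table_bracket)
      (simp_all add: basis_product_def comb3_def axis_def XX xX Xx Xw xx central)
qed

end

end

section \<open>Splitting the quadratic and combining the cases\<close>

lemma monic_quadratic_splits:
  fixes r c :: "'f::alg_closed_field"
  obtains m1 m2 where "r = - m1 - m2" "c = m1 * m2"
proof -
  obtain m where "poly [:c, r, 1:] m = 0"
    using alg_closed_imp_poly_has_root[of "[:c, r, 1:]"] by auto
  then have "c + m * (r + m) = 0" by simp
  then have "c = - (m * (r + m))" by (simp only: eq_neg_iff_add_eq_0)
  then have "c = m * (- r - m)"
    by (simp only: minus_mult_right minus_add_distrib diff_conv_add_uminus)
  then show thesis using that[of m "- r - m"] by simp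
qed

theorem theorem6p4:
  fixes scale :: "'f::{alg_closed_field, field_char_0} \<Rightarrow> 'a::ab_group_add \<Rightarrow> 'a"
    and br :: "'a \<Rightarrow> 'a \<Rightarrow> 'a"
  assumes "leibniz_algebra scale br"
    and "\<not> is_lie br"
    and "nilpotent_algebra br"
    and "vector_space.dim scale (UNIV :: 'a set) = 3"
  shows
    "leibniz_isomorphic scale br (*s) (table_bracket [((1, 1), basis_y), ((1, 2), basis_z)]) \<or>
     leibniz_isomorphic scale br (*s) (table_bracket [((1, 1), basis_z)]) \<or>
     leibniz_isomorphic scale br (*s) (table_bracket [((1, 2), basis_z), ((2, 1), basis_z)]) \<or>
     leibniz_isomorphic scale br (*s)
       (table_bracket [((1, 2), basis_z), ((2, 1), - basis_z), ((2, 2), basis_z)]) \<or>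
     (\<exists>\<alpha>. \<alpha> \<notin> {1, -1} \<and>
        leibniz_isomorphic scale br (*s) (table_bracket [((1, 2), basis_z), ((2, 1), \<alpha> *s basis_z)]))"
    (is "?I1 \<or> ?I2 \<or> ?I3 \<or> ?I4 \<or> ?I5")
proof -
  interpret leibniz_algebra scale br by fact
  note nil = assms(3) and dim = assms(4)
  show ?thesis
  proof (cases "\<exists>x. br x (br x x) \<noteq> 0")
    case True
    then show ?thesis using isomorphic_one_generator[OF dim nil] by blast
  next
    case False
    then have cube: "br x (br x x) = 0" for x by blast
    obtain x where x: "br x x \<noteq> 0" using assms(2) unfolding is_lie_def by blast
    obtain t r c where t: "indep3 x t (br x x)" "br x t = 0" "br t x = scale r (br x x)"
      "br t t = scale c (br x x)" "br t (br x x) = 0"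
      using form_normal_form[OF _ dim nil cube x] by auto
    obtain m1 m2 where m: "r = - m1 - m2" "c = m1 * m2" by (rule monic_quadratic_splits)
    \<comment> \<open>The two roots can be exchanged. This serves the case of distinct roots with
      \<open>m2 = 0\<close>, where one has to divide by \<open>m1\<close>.\<close>
    have m': "r = - m2 - m1" "c = m2 * m1" using m by simp_all
    note t1 = t(1) refl t(2) t(3)[unfolded m] t(4)[unfolded m] br_square_left cube t(5)
    note t2 = t(1) refl t(2) t(3)[unfolded m'] t(4)[unfolded m'] br_square_left cube t(5)
    have distinct: ?thesis
      if iso: "leibniz_isomorphic scale br (*s)
          (table_bracket [((1, 2), basis_z), ((2, 1), (- a / b) *s basis_z)])"
        and ab: "a \<noteq> b" "b \<noteq> 0" for a b
    proof -
      define \<alpha> where "\<alpha> = - a / b"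
      note iso = iso[folded \<alpha>_def]
      \<comment> \<open>The value -1 would force \<open>a = b\<close>; the value 1 gives type (3),
        all others type (5).\<close>
      have "\<alpha> \<noteq> - 1" unfolding \<alpha>_def using ab by simp
      moreover have ?I3 if "\<alpha> = 1" using iso unfolding that by simp
      ultimately show ?thesis using iso by blast
    qed
    show ?thesis
    proof (cases "m1 = m2")
      case True
      then show ?thesis
        using isomorphic_zero_root[OF dim t1] isomorphic_double_root[OF dim t1] by blast
    next
      case False
      show ?thesis
      proof (cases "m2 = 0")
        case True
        then show ?thesis
          using distinct[OF isomorphic_distinct_roots[OF dim t2]] False by auto
      next
        case m2: False
        then show ?thesis
          using distinct[OF isomorphic_distinct_roots[OF dim t1]] False by auto
      qed
    qed
  qed
qed

end
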